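(* Let $M$ be a surface immersed in $\mathbb{R}^4$ and $m\in M$. If a vector $x\in T_mM$ satisfies one of the following: 1. $\alpha(x,x) \ne 0$, $J\alpha(x,x)\cdot\alpha(x,Jx)\ne 0$ and $\det\big(\alpha(x,Jx),(\nabla_x\alpha)(x,x)\big)=0$; or 2. $\alpha(x,x) \ne 0$, $\alpha(x,Jx)= 0$, and at least one of $\alpha(x,x)\cdot(\nabla_x\alpha)(x,x)=0$ or $J\alpha(x,x)\cdot (\nabla_x\alpha)(x,x)\ne 0$ holds; then $x$ defines a strong principal direction at $m$.
   Context: $D$ denotes the directional derivative in $\mathbb{R}^4$, $g$ the first fundamental form, $N_mM$ the normal plane of $M$ at $m$, and $X=X^\top+X^\bot$ the decomposition into tangent and normal parts. The second fundamental form is $\alpha(X,Y)=(D_XY)^\bot$; with $\nabla^\top_XY=(D_XY)^\top$ and $\nabla^\bot_Xu=(D_Xu)^\bot$, its covariant derivative is $(\nabla_X\alpha)(Y,Z)=\nabla^\bot_X(\alpha(Y,Z))-\alpha(\nabla^\top_XY,Z)-\alpha(Y,\nabla^\top_XZ)$. $J$ denotes a rotation by 90 degrees in the plane $T_mM$ and also a rotation by 90 degrees in the plane $N_mM$ (for chosen orientations). The determinant of two vectors in the two-dimensional space $N_mM$ is taken with respect to an orthonormal basis. For $0\neq u\in\mathbb{R}^4$, let $d_{3,u}$ be the third order Taylor polynomial at $0$ of the function $x\in T_mM\mapsto \|\exp_m(x)-(m+u)\|^2-\|u\|^2$, where $\exp_m$ is the exponential map of $M$ at $m$; explicitly $$d_{3,u}(x)=-2u\cdot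 x+x\cdot x-u\cdot \alpha(x,x)+\tfrac13\alpha(u^\top,x)\cdot\alpha(x,x)-\tfrac13 u^\bot\cdot(\nabla_x\alpha)(x,x).$$ A vector $0\neq x\in T_mM$ defines a strong principal direction at $m$ if there is $0\ne u\in\mathbb{R}^4$ (said to determine a rib direction at $m$) such that: (i) $u\in N_mM$; (ii) $g(x,\cdot)-u\cdot\alpha(x,\cdot)=0$ on $T_mM$; (iii) $d_{3,u}(x)=0$. *)

theory Defs
  imports "HOL-Analysis.Analysis"
begin

section \<open>Surfaces immersed in four-space\<close>

text \<open>Meant for open \<open>U\<close>, where \<open>k\<close>-fold differentiability in all directions with continuous
  iterated derivatives is the class \<open>C\<^sup>k\<close>.\<close>

primrec Ck_on ::
    "nat \<Rightarrow> ('a::real_normed_vector \<Rightarrow> 'b::real_normed_vector) \<Rightarrow> 'a set \<Rightarrow> bool" where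
  "Ck_on 0 f U \<longleftrightarrow> continuous_on U f"
| "Ck_on (Suc k) f U \<longleftrightarrow> (\<forall>p\<in>U. f differentiable (at p)) \<and>
     (\<forall>v. Ck_on k (\<lambda>p. frechet_derivative f (at p) v) U)"

definition smooth_on ::
    "('a::real_normed_vector \<Rightarrow> 'b::real_normed_vector) \<Rightarrow> 'a set \<Rightarrow> bool" where
  "smooth_on f U \<longleftrightarrow> (\<forall>k. Ck_on k f U)"

text \<open>A chart is a pair \<open>(U, \<phi>)\<close> of an open \<open>U\<close> in the plane and a local parametrization
  \<open>\<phi>\<close> from \<open>U\<close> to the surface, i.e. the inverse of a coordinate map. Values of \<open>\<phi>\<close> outside
  \<open>U\<close> are irrelevant.\<close>

type_synonym 'a chart = "(real^2) set \<times> (real^2 \<Rightarrow> 'a)"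

definition smooth_surface :: "'a topology \<Rightarrow> 'a chart set \<Rightarrow> bool" where
  "smooth_surface X A \<longleftrightarrow>
     Hausdorff_space X \<and> second_countable X \<and>
     (\<forall>(U, \<phi>) \<in> A. open U \<and> openin X (\<phi> ` U) \<and>
        homeomorphic_map (top_of_set U) (subtopology X (\<phi> ` U)) \<phi>) \<and>
     (\<Union>(U, \<phi>) \<in> A. \<phi> ` U) = topspace X \<and>
     (\<forall>(U, \<phi>) \<in> A. \<forall>(V, \<psi>) \<in> A.
        smooth_on (\<lambda>p. inv_into V \<psi> (\<phi> p)) {p \<in> U. \<phi> p \<in> \<psi> ` V})"

definition immersed_surface :: "'a topology \<Rightarrow> 'a chart set \<Rightarrow> ('a \<Rightarrow> real^4) \<Rightarrow> bool" where
  "immersed_surface X A F \<longleftrightarrow> smooth_surface X A \<and>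
     (\<forall>(U, \<phi>) \<in> A. smooth_on (F \<circ> \<phi>) U \<and>
        (\<forall>p\<in>U. inj (frechet_derivative (F \<circ> \<phi>) (at p))))"

section \<open>Local geometry in a parametrization\<close>

text \<open>In this section \<open>f\<close> is a local parametrization \<open>F \<circ> \<phi>\<close> of the immersed surface by an open
  subset of the plane and \<open>p\<close> is a parameter value. The corresponding point is \<open>m = f p\<close>; it is
  addressed by \<open>p\<close> because an immersed surface may pass through \<open>m\<close> several times.\<close>

definition tangent_plane :: "(real^2 \<Rightarrow> real^4) \<Rightarrow> real^2 \<Rightarrow> (real^4) set" where
  "tangent_plane f p = range (frechet_derivative f (at p))"

definition normal_plane :: "(real^2 \<Rightarrow> real^4) \<Rightarrow> real^2 \<Rightarrow> (real^4) set" where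
  "normal_plane f p = (tangent_plane f p)\<^sup>\<bottom>"

definition tangent_part :: "(real^2 \<Rightarrow> real^4) \<Rightarrow> real^2 \<Rightarrow> real^4 \<Rightarrow> real^4" where
  "tangent_part f p v = (THE t. t \<in> tangent_plane f p \<and> v - t \<in> normal_plane f p)"

definition normal_part :: "(real^2 \<Rightarrow> real^4) \<Rightarrow> real^2 \<Rightarrow> real^4 \<Rightarrow> real^4" where
  "normal_part f p v = v - tangent_part f p v"

text \<open>Vector fields along the surface are maps from parameters to \<open>\<real>\<^sup>4\<close>.  For tangent \<open>X\<close>,
  the directional derivative of \<open>Y\<close> in the direction \<open>X p\<close> is the derivative of \<open>Y\<close>, as a
  function of the parameter, along the unique parameter vector that \<open>f\<close> pushes forward to
  \<open>X p\<close>.\<close>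

type_synonym field_along = "real^2 \<Rightarrow> real^4"

definition dir_deriv ::
    "(real^2 \<Rightarrow> real^4) \<Rightarrow> field_along \<Rightarrow> field_along \<Rightarrow> field_along" where
  "dir_deriv f X Y = (\<lambda>p. frechet_derivative Y (at p) (inv (frechet_derivative f (at p)) (X p)))"

definition tangent_connection ::
    "(real^2 \<Rightarrow> real^4) \<Rightarrow> field_along \<Rightarrow> field_along \<Rightarrow> field_along" where
  "tangent_connection f X Y = (\<lambda>p. tangent_part f p (dir_deriv f X Y p))"

definition normal_connection ::
    "(real^2 \<Rightarrow> real^4) \<Rightarrow> field_along \<Rightarrow> field_along \<Rightarrow> field_along" where
  "normal_connection f X u = (\<lambda>p. normal_part f p (dir_deriv f X u p))"

definition second_ff_field ::
    "(real^2 \<Rightarrow> real^4) \<Rightarrow> field_along \<Rightarrow> field_along \<Rightarrow> field_along" where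
  "second_ff_field f X Y = (\<lambda>p. normal_part f p (dir_deriv f X Y p))"

definition deriv_second_ff_field ::
    "(real^2 \<Rightarrow> real^4) \<Rightarrow> field_along \<Rightarrow> field_along \<Rightarrow> field_along \<Rightarrow> field_along" where
  "deriv_second_ff_field f X Y Z = (\<lambda>p.
     normal_connection f X (second_ff_field f Y Z) p
     - second_ff_field f (tangent_connection f X Y) Z p
     - second_ff_field f Y (tangent_connection f X Z) p)"

text \<open>Both expressions are tensorial in the tangent fields, so their values on tangent vectors at
  \<open>p\<close> may be computed with any smooth tangent extensions.  We use the extensions with constant
  components in the coordinate frame of \<open>f\<close>.\<close>

definition extend_tangent :: "(real^2 \<Rightarrow> real^4) \<Rightarrow> real^2 \<Rightarrow> real^4 \<Rightarrow> field_along" where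
  "extend_tangent f p x =
     (\<lambda>q. frechet_derivative f (at q) (inv (frechet_derivative f (at p)) x))"

definition second_ff :: "(real^2 \<Rightarrow> real^4) \<Rightarrow> real^2 \<Rightarrow> real^4 \<Rightarrow> real^4 \<Rightarrow> real^4" where
  "second_ff f p x y = second_ff_field f (extend_tangent f p x) (extend_tangent f p y) p"

definition deriv_second_ff ::
    "(real^2 \<Rightarrow> real^4) \<Rightarrow> real^2 \<Rightarrow> real^4 \<Rightarrow> real^4 \<Rightarrow> real^4 \<Rightarrow> real^4" where
  "deriv_second_ff f p x y z = deriv_second_ff_field f
     (extend_tangent f p x) (extend_tangent f p y) (extend_tangent f p z) p"

text \<open>The first fundamental form is the metric induced from \<open>\<real>\<^sup>4\<close>; it is only applied to tangent
  vectors.\<close>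

definition first_ff :: "real^4 \<Rightarrow> real^4 \<Rightarrow> real" where
  "first_ff x y = x \<bullet> y"

section \<open>Planes in four-space\<close>

text \<open>For a two-dimensional \<open>P\<close>, the maps below are the two rotations of \<open>P\<close> by 90 degrees, one
  for each orientation.\<close>

definition rotation90_on :: "(real^4) set \<Rightarrow> (real^4 \<Rightarrow> real^4) \<Rightarrow> bool" where
  "rotation90_on P J \<longleftrightarrow>
     (\<forall>v\<in>P. \<forall>w\<in>P. \<forall>a b. J (a *\<^sub>R v + b *\<^sub>R w) = a *\<^sub>R J v + b *\<^sub>R J w) \<and>
     (\<forall>v\<in>P. J v \<in> P \<and> norm (J v) = norm v \<and> v \<bullet> J v = 0)"

definition orthonormal_basis_of :: "(real^4) set \<Rightarrow> real^4 \<Rightarrow> real^4 \<Rightarrow> bool" where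
  "orthonormal_basis_of P e1 e2 \<longleftrightarrow>
     span {e1, e2} = P \<and> norm e1 = 1 \<and> norm e2 = 1 \<and> e1 \<bullet> e2 = 0"

definition plane_det :: "real^4 \<Rightarrow> real^4 \<Rightarrow> real^4 \<Rightarrow> real^4 \<Rightarrow> real" where
  "plane_det e1 e2 v w =
     det (vector [vector [v \<bullet> e1, w \<bullet> e1], vector [v \<bullet> e2, w \<bullet> e2]] :: real^2^2)"

section \<open>Strong principal directions\<close>

text \<open>The third order Taylor polynomial at \<open>0\<close> of
  \<open>x \<mapsto> \<parallel>exp\<^sub>m x - (m + u)\<parallel>\<^sup>2 - \<parallel>u\<parallel>\<^sup>2\<close> on the tangent plane at \<open>m = f p\<close>.\<close>

definition d3 :: "(real^2 \<Rightarrow> real^4) \<Rightarrow> real^2 \<Rightarrow> real^4 \<Rightarrow> real^4 \<Rightarrow> real" where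
  "d3 f p u x =
     - 2 * (u \<bullet> x) + x \<bullet> x - u \<bullet> second_ff f p x x
     + 1/3 * (second_ff f p (tangent_part f p u) x \<bullet> second_ff f p x x)
     - 1/3 * (normal_part f p u \<bullet> deriv_second_ff f p x x x)"

definition strong_principal_direction ::
    "(real^2 \<Rightarrow> real^4) \<Rightarrow> real^2 \<Rightarrow> real^4 \<Rightarrow> bool" where
  "strong_principal_direction f p x \<longleftrightarrow>
     x \<in> tangent_plane f p \<and> x \<noteq> 0 \<and>
     (\<exists>u. u \<noteq> 0 \<and> u \<in> normal_plane f p \<and>
        (\<forall>y\<in>tangent_plane f p. first_ff x y - u \<bullet> second_ff f p x y = 0) \<and>
        d3 f p u x = 0)"

end

theory Submission
  imports Defs
begin

text \<open>Write \<open>a = \<alpha>(x, x)\<close>, \<open>b = \<alpha>(x, Jx)\<close> and \<open>c = (\<nabla>\<^sub>x\<alpha>)(x, x)\<close>; all three lie in the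
  normal plane. For \<open>x \<noteq> 0\<close> the vectors \<open>x\<close> and \<open>Jx\<close> form an orthogonal basis of the tangent
  plane, and \<open>\<alpha>(x, \<cdot>)\<close> is linear there, so for a normal vector \<open>u\<close> the linear condition
  \<open>g(x, \<cdot>) = u \<cdot> \<alpha>(x, \<cdot>)\<close> says exactly \<open>u \<cdot> a = x \<cdot> x\<close> and \<open>u \<cdot> b = 0\<close>. Given these, every
  term of the cubic \<open>d\<^sub>3\<^sub>,\<^sub>u(x)\<close> cancels except \<open>- (u \<cdot> c) / 3\<close>. A rib direction is therefore a solution
  \<open>u\<close> in the normal plane of the linear system
  \<open>u \<cdot> a = x \<cdot> x\<close>, \<open>u \<cdot> b = 0\<close>, \<open>u \<cdot> c = 0\<close>,
  which is three equations for two unknowns (\<open>strong_principal_directionI\<close>).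

  The two hypotheses of the theorem make this system solvable. If \<open>J'a \<cdot> b \<noteq> 0\<close>, the first two
  equations are solved by a multiple of \<open>J'b\<close>, and the third one is then the vanishing of the
  determinant of \<open>b\<close> and \<open>c\<close>. If \<open>b = 0\<close>, the second equation disappears; the other two are
  solved by a multiple of \<open>a\<close> when \<open>a\<close> and \<open>c\<close> are orthogonal, and by a multiple of \<open>J'c\<close>
  when \<open>a\<close> and \<open>c\<close> are linearly independent.\<close>

section \<open>Rotations of a plane\<close>

lemma rotation90_skew:
  assumes "rotation90_on P J" "v \<in> P" "w \<in> P" "subspace P"
  shows "J v \<bullet> w = - (v \<bullet> J w)"
proof -
  have "J (1 *\<^sub>R v + 1 *\<^sub>R w) = 1 *\<^sub>R J v + 1 *\<^sub>R J w"
    using assms unfolding rotation90_on_def by blast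
  then have "J (v + w) = J v + J w" by simp
  moreover have "v \<bullet> J v = 0" "w \<bullet> J w = 0" "(v + w) \<bullet> J (v + w) = 0"
    using assms subspace_add unfolding rotation90_on_def by blast+
  ultimately show ?thesis
    by (simp add: inner_add_left inner_add_right inner_commute)
qed

lemma plane_subset_span_rotation90:
  assumes P: "subspace P" "dim P = 2" and J: "rotation90_on P J" and v: "v \<in> P" "v \<noteq> 0"
  shows "P \<subseteq> span {v, J v}"
proof -
  have Jv: "J v \<in> P" "norm (J v) = norm v" "v \<bullet> J v = 0"
    using J v unfolding rotation90_on_def by auto
  have ne: "J v \<noteq> 0" using Jv v by auto
  have "v \<noteq> J v" using Jv(3) v by auto
  then have card: "card {v, J v} = 2" by simp
  have "pairwise orthogonal {v, J v}"
    using Jv(3) by (auto simp: pairwise_def orthogonal_def inner_commute)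
  then have "independent {v, J v}"
    using pairwise_orthogonal_independent[of "{v, J v}"] v ne by auto
  then show ?thesis
    using card_ge_dim_independent[of "{v, J v}" P] v Jv card P by auto
qed

text \<open>The vanishing determinant makes \<open>c\<close> a multiple of \<open>b \<noteq> 0\<close>, and \<open>J b\<close> is orthogonal to \<open>b\<close>.
  Calculating in coordinates avoids finding the factor.\<close>

lemma inner_rotation90_eq_0_if_plane_det_eq_0:
  assumes basis: "orthonormal_basis_of P e1 e2" and J: "rotation90_on P J"
    and b: "b \<in> P" "b \<noteq> 0" and c: "c \<in> P" and det: "plane_det e1 e2 b c = 0"
  shows "J b \<bullet> c = 0"
proof -
  have e: "e1 \<bullet> e1 = 1" "e2 \<bullet> e2 = 1" "e1 \<bullet> e2 = 0" "e2 \<bullet> e1 = 0"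
    and P: "P = span {e1, e2}"
    using basis unfolding orthonormal_basis_of_def
    by (auto simp: norm_eq_1 inner_commute)
  have coords: "\<exists>s t. v = s *\<^sub>R e1 + t *\<^sub>R e2" if "v \<in> P" for v
    using that unfolding P span_insert span_singleton
    by (auto simp: algebra_simps)
  have Jb: "J b \<in> P" "b \<bullet> J b = 0" using J b unfolding rotation90_on_def by auto
  obtain b1 b2 where b_eq: "b = b1 *\<^sub>R e1 + b2 *\<^sub>R e2" using coords b by blast
  obtain c1 c2 where c_eq: "c = c1 *\<^sub>R e1 + c2 *\<^sub>R e2" using coords c by blast
  obtain j1 j2 where j_eq: "J b = j1 *\<^sub>R e1 + j2 *\<^sub>R e2" using coords Jb by blast
  have det0: "b1 * c2 = c1 * b2"
    using det by (simp add: plane_det_def det_2 b_eq c_eq inner_add_left e)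
  have bJb: "b1 * j1 + b2 * j2 = 0"
    using Jb(2) unfolding j_eq by (simp add: b_eq inner_add_left inner_add_right e algebra_simps)
  have "b1 * (j1 * c1 + j2 * c2) = 0" "b2 * (j1 * c1 + j2 * c2) = 0"
    using det0 bJb by algebra+
  moreover have "b1 \<noteq> 0 \<or> b2 \<noteq> 0" using b(2) b_eq by auto
  ultimately have "j1 * c1 + j2 * c2 = 0" by auto
  then show ?thesis
    unfolding j_eq by (simp add: c_eq inner_add_left inner_add_right e algebra_simps)
qed

section \<open>Tangent and normal parts\<close>

lemma subspace_tangent_plane:
  assumes "f differentiable (at p)"
  shows "subspace (tangent_plane f p)"
  unfolding tangent_plane_def
  using linear_frechet_derivative[OF assms] by (intro linear_subspace_image) auto

lemma dim_tangent_plane: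
  assumes "f differentiable (at p)" "inj (frechet_derivative f (at p))"
  shows "dim (tangent_plane f p) = 2"
  using dim_image_eq[OF linear_frechet_derivative[OF assms(1)], of UNIV] assms(2)
  by (simp add: tangent_plane_def)

lemma subspace_normal_plane: "subspace (normal_plane f p)"
  unfolding normal_plane_def by (rule subspace_orthogonal_comp)

lemma inner_tangent_normal:
  assumes "t \<in> tangent_plane f p" "u \<in> normal_plane f p"
  shows "u \<bullet> t = 0"
  using assms by (auto simp: normal_plane_def orthogonal_comp_def orthogonal_def inner_commute)

lemma tangent_part_eqI:
  assumes sub: "subspace (tangent_plane f p)"
    and t: "t \<in> tangent_plane f p" "v - t \<in> normal_plane f p"
  shows "tangent_part f p v = t"
  unfolding tangent_part_def
proof (rule the_equality)
  fix t' assume t': "t' \<in> tangent_plane f p \<and> v - t' \<in> normal_plane f p"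
  have "t - t' \<in> tangent_plane f p" using t t' subspace_diff[OF sub] by blast
  moreover have "(v - t') - (v - t) \<in> normal_plane f p"
    using t t' subspace_diff[OF subspace_normal_plane] by blast
  ultimately have "(t - t') \<bullet> (t - t') = 0" using inner_tangent_normal by fastforce
  then show "t' = t" by simp
qed (use t in simp)

lemma tangent_part_decomposition:
  assumes "subspace (tangent_plane f p)"
  shows "tangent_part f p v \<in> tangent_plane f p \<and> normal_part f p v \<in> normal_plane f p"
proof -
  obtain y z where yz: "y \<in> span (tangent_plane f p)"
      "\<And>w. w \<in> span (tangent_plane f p) \<Longrightarrow> orthogonal z w" "v = y + z"
    using orthogonal_subspace_decomp_exists by metis
  then have "y \<in> tangent_plane f p" "v - y \<in> normal_plane f p"
    using span_eq_iff[THEN iffD2, OF assms]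
    by (auto simp: normal_plane_def orthogonal_comp_def orthogonal_commute)
  then show ?thesis
    using tangent_part_eqI[OF assms] by (simp add: normal_part_def)
qed

lemma normal_part_in_normal_plane:
  "subspace (tangent_plane f p) \<Longrightarrow> normal_part f p v \<in> normal_plane f p"
  using tangent_part_decomposition by blast

lemma inner_normal_part:
  assumes "subspace (tangent_plane f p)" "u \<in> normal_plane f p"
  shows "u \<bullet> normal_part f p v = u \<bullet> v"
  using inner_tangent_normal[OF _ assms(2)] tangent_part_decomposition[OF assms(1)]
  by (simp add: normal_part_def inner_diff_right)

lemma tangent_part_of_normal:
  assumes "subspace (tangent_plane f p)" "u \<in> normal_plane f p"
  shows "tangent_part f p u = 0"
  using tangent_part_eqI[OF assms(1) subspace_0[OF assms(1)], of u] assms(2) by simp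

section \<open>The second fundamental form\<close>

lemma second_ff_in_normal_plane:
  "subspace (tangent_plane f p) \<Longrightarrow> second_ff f p x y \<in> normal_plane f p"
  by (simp add: second_ff_def second_ff_field_def normal_part_in_normal_plane)

lemma deriv_second_ff_in_normal_plane:
  assumes "subspace (tangent_plane f p)"
  shows "deriv_second_ff f p x y z \<in> normal_plane f p"
  unfolding deriv_second_ff_def deriv_second_ff_field_def second_ff_field_def
    normal_connection_def
  by (intro subspace_diff[OF subspace_normal_plane] normal_part_in_normal_plane assms)

lemma smooth_onD:
  assumes "smooth_on f U" "q \<in> U"
  shows "f differentiable (at q)"
    and "(\<lambda>q. frechet_derivative f (at q) w) differentiable (at q)"
proof -
  have "Ck_on (Suc (Suc 0)) f U" using assms(1) unfolding smooth_on_def by blast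
  then show "f differentiable (at q)"
    "(\<lambda>q. frechet_derivative f (at q) w) differentiable (at q)"
    using assms(2) by auto
qed

text \<open>A normal vector does not see tangent parts, so paired with it the second fundamental form
  is the plain second derivative of the parametrization. This reduces the algebraic properties
  of \<open>\<alpha>\<close> to those of a second derivative.\<close>

lemma inner_second_ff:
  assumes "subspace (tangent_plane f p)" "u \<in> normal_plane f p" "x \<in> tangent_plane f p"
  defines "D \<equiv> frechet_derivative f (at p)"
  shows "u \<bullet> second_ff f p x y =
    u \<bullet> frechet_derivative (\<lambda>q. frechet_derivative f (at q) (inv D y)) (at p) (inv D x)"
proof -
  have "D (inv D x) = x"
    using assms(3) unfolding tangent_plane_def D_def by (rule f_inv_into_f)
  then show ?thesis
    using inner_normal_part[OF assms(1,2)]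
    by (simp add: second_ff_def second_ff_field_def dir_deriv_def extend_tangent_def D_def)
qed

text \<open>The derivative of \<open>f\<close> is linear in its direction at every point of \<open>U\<close>, hence on a
  neighbourhood of \<open>p\<close>, and this passes to the derivative at \<open>p\<close>.\<close>

lemma frechet_derivative_frechet_derivative_linear:
  assumes U: "open U" "p \<in> U" and f: "smooth_on f U"
  shows "frechet_derivative (\<lambda>q. frechet_derivative f (at q) (s *\<^sub>R v + t *\<^sub>R w)) (at p) h =
    s *\<^sub>R frechet_derivative (\<lambda>q. frechet_derivative f (at q) v) (at p) h
    + t *\<^sub>R frechet_derivative (\<lambda>q. frechet_derivative f (at q) w) (at p) h"
proof -
  let ?d = "\<lambda>v q. frechet_derivative f (at q) v"
  have der: "(?d v has_derivative frechet_derivative (?d v) (at p)) (at p)" for v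
    using smooth_onD(2)[OF f U(2)] frechet_derivative_works by blast
  have sum: "((\<lambda>q. s *\<^sub>R ?d v q + t *\<^sub>R ?d w q) has_derivative
      (\<lambda>h. s *\<^sub>R frechet_derivative (?d v) (at p) h + t *\<^sub>R frechet_derivative (?d w) (at p) h))
      (at p)"
    by (intro has_derivative_add has_derivative_scaleR_right der)
  have eq: "s *\<^sub>R ?d v q + t *\<^sub>R ?d w q = ?d (s *\<^sub>R v + t *\<^sub>R w) q" if "q \<in> U" for q
    using linear_frechet_derivative[OF smooth_onD(1)[OF f that]]
    by (simp add: linear_add linear_cmul)
  have "(?d (s *\<^sub>R v + t *\<^sub>R w) has_derivative
      (\<lambda>h. s *\<^sub>R frechet_derivative (?d v) (at p) h + t *\<^sub>R frechet_derivative (?d w) (at p) h))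
      (at p)"
    by (rule has_derivative_transform_within_open[OF sum U eq])
  from fun_cong[OF frechet_derivative_at[OF this], of h] show ?thesis by (rule sym)
qed

context
  fixes f :: "real^2 \<Rightarrow> real^4" and U :: "(real^2) set" and p :: "real^2"
  assumes U: "open U" "p \<in> U" and smooth: "smooth_on f U"
    and inj: "inj (frechet_derivative f (at p))"
begin

private lemma tangent_plane_subspace: "subspace (tangent_plane f p)"
  using subspace_tangent_plane smooth_onD(1)[OF smooth U(2)] by blast

lemma inner_second_ff_linear:
  assumes u: "u \<in> normal_plane f p" and x: "x \<in> tangent_plane f p"
    and v: "v \<in> tangent_plane f p" and w: "w \<in> tangent_plane f p"
  shows "u \<bullet> second_ff f p x (s *\<^sub>R v + t *\<^sub>R w) =
    s * (u \<bullet> second_ff f p x v) + t * (u \<bullet> second_ff f p x w)"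
proof -
  let ?D = "frechet_derivative f (at p)"
  have lin: "linear ?D" using linear_frechet_derivative smooth_onD(1)[OF smooth U(2)] by blast
  have inv: "?D (inv ?D y) = y" if "y \<in> tangent_plane f p" for y
    using that unfolding tangent_plane_def by (rule f_inv_into_f)
  have "inv ?D (s *\<^sub>R v + t *\<^sub>R w) = s *\<^sub>R inv ?D v + t *\<^sub>R inv ?D w"
    by (rule inv_f_eq[OF inj]) (simp add: linear_add[OF lin] linear_cmul[OF lin] inv v w)
  then show ?thesis
    by (simp add: inner_second_ff[OF tangent_plane_subspace u x] inner_add_right
        frechet_derivative_frechet_derivative_linear[OF U smooth])
qed

lemma second_ff_zero_left: "second_ff f p 0 y = 0"
proof -
  let ?D = "frechet_derivative f (at p)" and ?a = "second_ff f p 0 y"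
  have "linear ?D" using linear_frechet_derivative smooth_onD(1)[OF smooth U(2)] by blast
  then have "inv ?D 0 = 0" by (intro inv_f_eq[OF inj] linear_0)
  moreover have "linear (frechet_derivative (\<lambda>q. frechet_derivative f (at q) w) (at p))" for w
    using linear_frechet_derivative smooth_onD(2)[OF smooth U(2)] by blast
  ultimately have "?a \<bullet> ?a = 0"
    using inner_second_ff[OF tangent_plane_subspace
        second_ff_in_normal_plane[OF tangent_plane_subspace] subspace_0[OF tangent_plane_subspace]]
    by (simp add: linear_0)
  then show ?thesis by simp
qed

text \<open>The rib direction condition as a linear system for \<open>u\<close>: the linear condition need only be
  tested on the basis \<open>x\<close>, \<open>J x\<close> of the tangent plane.\<close>

lemma strong_principal_directionI:
  assumes J: "rotation90_on (tangent_plane f p) J"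
    and x: "x \<in> tangent_plane f p" "x \<noteq> 0" and u: "u \<in> normal_plane f p"
    and ua: "u \<bullet> second_ff f p x x = x \<bullet> x"
    and ub: "u \<bullet> second_ff f p x (J x) = 0"
    and uc: "u \<bullet> deriv_second_ff f p x x x = 0"
  shows "strong_principal_direction f p x"
proof -
  have Jx: "J x \<in> tangent_plane f p" "x \<bullet> J x = 0"
    using J x unfolding rotation90_on_def by auto
  have "first_ff x y - u \<bullet> second_ff f p x y = 0" if y: "y \<in> tangent_plane f p" for y
  proof -
    have "y \<in> span {x, J x}"
      using plane_subset_span_rotation90[OF tangent_plane_subspace
          dim_tangent_plane[OF smooth_onD(1)[OF smooth U(2)] inj] J x] y by blast
    then obtain s t where "y = s *\<^sub>R x + t *\<^sub>R J x"
      unfolding span_insert span_singleton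
      by (auto simp: algebra_simps)
    then show ?thesis
      by (simp add: first_ff_def inner_second_ff_linear[OF u x(1) x(1) Jx(1)] ua ub
          inner_add_right Jx(2))
  qed
  moreover have "d3 f p u x = 0"
    by (simp add: d3_def tangent_part_of_normal[OF tangent_plane_subspace u] normal_part_def
        second_ff_zero_left inner_tangent_normal[OF x(1) u] ua uc)
  moreover have "u \<noteq> 0" using ua x(2) by auto
  ultimately show ?thesis unfolding strong_principal_direction_def using x u by blast
qed

text \<open>Only the line spanned by \<open>u\<close> matters, because a multiple can be chosen to meet the
  inhomogeneous equation as soon as its left-hand side does not vanish on the line.\<close>

lemma strong_principal_direction_rescaleI:
  assumes J: "rotation90_on (tangent_plane f p) J"
    and x: "x \<in> tangent_plane f p" and u: "u \<in> normal_plane f p"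
    and ua: "u \<bullet> second_ff f p x x \<noteq> 0"
    and ub: "u \<bullet> second_ff f p x (J x) = 0"
    and uc: "u \<bullet> deriv_second_ff f p x x x = 0"
  shows "strong_principal_direction f p x"
proof (rule strong_principal_directionI[OF J x])
  show "x \<noteq> 0" using ua second_ff_zero_left by auto
  show "(x \<bullet> x / (u \<bullet> second_ff f p x x)) *\<^sub>R u \<in> normal_plane f p"
    using u subspace_scale[OF subspace_normal_plane] by blast
qed (use ua ub uc in simp_all)

end

theorem theorem5p2:
  fixes X :: "'a topology" and A :: "'a chart set" and F :: "'a \<Rightarrow> real^4"
    and U :: "(real^2) set" and \<phi> :: "real^2 \<Rightarrow> 'a" and f :: "real^2 \<Rightarrow> real^4"
    and p :: "real^2" and x e1 e2 :: "real^4" and J J' :: "real^4 \<Rightarrow> real^4"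
  assumes "immersed_surface X A F"
    and "(U, \<phi>) \<in> A" and "p \<in> U" and "f = F \<circ> \<phi>"
    and "rotation90_on (tangent_plane f p) J"
    and "rotation90_on (normal_plane f p) J'"
    and "orthonormal_basis_of (normal_plane f p) e1 e2"
    and "x \<in> tangent_plane f p"
    and "(second_ff f p x x \<noteq> 0 \<and>
          J' (second_ff f p x x) \<bullet> second_ff f p x (J x) \<noteq> 0 \<and>
          plane_det e1 e2 (second_ff f p x (J x)) (deriv_second_ff f p x x x) = 0)
       \<or> (second_ff f p x x \<noteq> 0 \<and>
          second_ff f p x (J x) = 0 \<and>
          (second_ff f p x x \<bullet> deriv_second_ff f p x x x = 0 \<or>
           J' (second_ff f p x x) \<bullet> deriv_second_ff f p x x x \<noteq> 0))"
  shows "strong_principal_direction f p x"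
proof -
  let ?T = "tangent_plane f p" and ?N = "normal_plane f p"
  let ?a = "second_ff f p x x" and ?b = "second_ff f p x (J x)"
    and ?c = "deriv_second_ff f p x x x"
  note J = assms(5) and J' = assms(6) and x = assms(8)
  have U: "open U" and smooth: "smooth_on f U" and inj: "inj (frechet_derivative f (at p))"
    using assms(1-4) unfolding immersed_surface_def smooth_surface_def by fast+
  have T: "subspace ?T" using subspace_tangent_plane smooth_onD(1)[OF smooth assms(3)] by blast
  have N: "?a \<in> ?N" "?b \<in> ?N" "?c \<in> ?N"
    using second_ff_in_normal_plane[OF T] deriv_second_ff_in_normal_plane[OF T] by blast+
  note rib = strong_principal_direction_rescaleI[OF U assms(3) smooth inj J x]
  note skew = rotation90_skew[OF J' _ _ subspace_normal_plane]
  have J'N: "J' v \<in> ?N" "v \<bullet> J' v = 0" if "v \<in> ?N" for v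
    using J' that unfolding rotation90_on_def by auto
  consider "J' ?a \<bullet> ?b \<noteq> 0" "plane_det e1 e2 ?b ?c = 0"
    | "?a \<noteq> 0" "?b = 0" "?a \<bullet> ?c = 0"
    | "?b = 0" "J' ?a \<bullet> ?c \<noteq> 0"
    using assms(9) by blast
  then show ?thesis
  proof cases
    case 1
    then have "?b \<noteq> 0" by auto
    show ?thesis
    proof (rule rib)
      show "J' ?b \<bullet> ?a \<noteq> 0" using 1(1) skew[OF N(1,2)] by (simp add: inner_commute)
      show "J' ?b \<bullet> ?b = 0" using J'N(2)[OF N(2)] by (simp add: inner_commute)
      show "J' ?b \<bullet> ?c = 0"
        by (rule inner_rotation90_eq_0_if_plane_det_eq_0[OF assms(7) J' N(2) \<open>?b \<noteq> 0\<close> N(3) 1(2)])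
    qed (rule J'N(1)[OF N(2)])
  next
    case 2
    then show ?thesis using rib[OF N(1)] by simp
  next
    case 3
    show ?thesis
    proof (rule rib)
      show "J' ?c \<bullet> ?a \<noteq> 0" using 3(2) skew[OF N(1,3)] by (simp add: inner_commute)
      show "J' ?c \<bullet> ?b = 0" using 3(1) by simp
      show "J' ?c \<bullet> ?c = 0" using J'N(2)[OF N(3)] by (simp add: inner_commute)
    qed (rule J'N(1)[OF N(3)])
  qed
qed

end
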